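(* Let $(X,\Gamma)$ and $(Y,\Lambda)$ be hyperbolic iterated function systems with attractors $\mathbb{A}$ and $\mathbb{B}$, respectively. If $(f,\alpha)\colon (X,\Gamma)\to(Y,\Lambda)$ is a morphism, then the attractor of the fibred system $(X\times Y,\Gamma\times_\alpha\Lambda)$ is the graph $$\mathrm{Gr}(f|_{\mathbb{A}}) := \{(x,f(x))\in X\times Y \mid x\in\mathbb{A}\}$$ of $f$ restricted to $\mathbb{A}$. Moreover, suppose that $\beta\colon\Gamma\to\Lambda$ is a function and $\mathbb{D}$ is the attractor of $(X\times Y,\Gamma\times_\beta\Lambda)$. Then there is a continuous function $g\colon\mathbb{A}\to\mathbb{B}$ making $(g,\beta)\colon(\mathbb{A},\Gamma)\to(\mathbb{B},\Lambda)$ a morphism if and only if $\mathbb{D}$ is the graph of a function from $\mathbb{A}$ to $\mathbb{B}$ (continuity of this function is automatic).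
   Context: A (hyperbolic) iterated function system $(X,\Gamma)$ consists of a nonempty complete metric space $(X,d)$ together with a nonempty finite collection $\Gamma$ of proper contractions on $X$: for each $\gamma\in\Gamma$, $\gamma\colon X\to X$ and there is $0\le c_\gamma<1$ with $d(\gamma(x),\gamma(y))\le c_\gamma d(x,y)$ for all $x,y\in X$. Distinct members of the collection $\Gamma$ are allowed to be equal as maps (distinct copies of the same map), i.e. $\Gamma$ may be regarded as an indexed family. Let $\mathcal{K}(X)$ be the set of nonempty compact subsets of $X$. The Hutchinson operator $\Gamma\colon\mathcal{K}(X)\to\mathcal{K}(X)$ is $\Gamma(K)=\bigcup_{\gamma\in\Gamma}\gamma(K)$. The attractor of $(X,\Gamma)$ is its unique fixed point in $\mathcal{K}(X)$ (it exists and is unique by Hutchinson's Theorem). A morphism $(f,\alpha)\colon(X,\Gamma)\to(Y,\Lambda)$ is a pair consisting of a continuous map $f\colon X\to Y$ and a function $\alpha\colon\Gamma\to\Lambda$ such that $f\circ\gamma=\alpha(\gamma)\circ f$ for every $\gamma\in\Gamma$. For a function $\alpha\colon\Gamma\to\Lambda$ and $\gamma\in\Gamma$ define $\gamma^\alpha\colon X\times Y\to X\times Y$ by $\gamma^\alpha(x,y)=(\gamma(x),\alpha(\gamma)(y))$, and let $\Gamma\times_\alpha\Lambda:=\{\gamma^\alpha\mid\gamma\in\Gamma\}$. With $X\times Y$ equipped with the metric $d_\infty((x_1,y_1),(x_2,y_2))=\max\{d_X(x_1,x_2),d_Y(y_1,y_2)\}$, the pair $(X\times Y,\Gamma\times_\alpha\Lambda)$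 is a hyperbolic iterated function system, called the system fibred over $\alpha$. $(\mathbb{A},\Gamma)$ denotes the iterated function system obtained by restricting the members of $\Gamma$ to the attractor $\mathbb{A}$ (which they map into itself), and similarly for $(\mathbb{B},\Lambda)$; members of $\Gamma$ whose restrictions coincide are still regarded as distinct. *)

theory Defs
  imports "HOL-Analysis.Analysis"
begin

text \<open>
  An iterated function system is kept as an indexed family of maps on an abstract metric space, so
  that members with distinct indices stay distinct even if they coincide as maps. Maps are total
  functions on the ambient type; only their values on the carrier of the metric space matter.
\<close>

record ('a, 'i) ifs =
  metric_of :: "'a metric"
  index_of :: "'i set"
  map_of_index :: "'i \<Rightarrow> 'a \<Rightarrow> 'a"

abbreviation space_of :: "('a, 'i) ifs \<Rightarrow> 'a set" where
  "space_of S \<equiv> mspace (metric_of S)"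

abbreviation topology_of :: "('a, 'i) ifs \<Rightarrow> 'a topology" where
  "topology_of S \<equiv> mtopology_of (metric_of S)"

definition proper_contraction :: "'a metric \<Rightarrow> ('a \<Rightarrow> 'a) \<Rightarrow> bool" where
  "proper_contraction m h \<longleftrightarrow>
     h \<in> mspace m \<rightarrow> mspace m \<and>
     (\<exists>c::real. 0 \<le> c \<and> c < 1 \<and>
        (\<forall>x\<in>mspace m. \<forall>y\<in>mspace m. mdist m (h x) (h y) \<le> c * mdist m x y))"

definition hyperbolic_ifs :: "('a, 'i) ifs \<Rightarrow> bool" where
  "hyperbolic_ifs S \<longleftrightarrow>
     space_of S \<noteq> {} \<and> mcomplete_of (metric_of S) \<and>
     index_of S \<noteq> {} \<and> finite (index_of S) \<and>
     (\<forall>i\<in>index_of S. proper_contraction (metric_of S) (map_of_index S i))"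

definition nonempty_compacts :: "('a, 'i) ifs \<Rightarrow> 'a set set" where
  "nonempty_compacts S = {K. K \<noteq> {} \<and> compactin (topology_of S) K}"

definition hutchinson :: "('a, 'i) ifs \<Rightarrow> 'a set \<Rightarrow> 'a set" where
  "hutchinson S K = (\<Union>i\<in>index_of S. map_of_index S i ` K)"

definition is_attractor :: "('a, 'i) ifs \<Rightarrow> 'a set \<Rightarrow> bool" where
  "is_attractor S A \<longleftrightarrow>
     A \<in> nonempty_compacts S \<and> hutchinson S A = A \<and>
     (\<forall>K\<in>nonempty_compacts S. hutchinson S K = K \<longrightarrow> K = A)"

definition ifs_morphism ::
    "('a, 'i) ifs \<Rightarrow> ('b, 'j) ifs \<Rightarrow> ('a \<Rightarrow> 'b) \<Rightarrow> ('i \<Rightarrow> 'j) \<Rightarrow> bool" where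
  "ifs_morphism S T f \<alpha> \<longleftrightarrow>
     continuous_map (topology_of S) (topology_of T) f \<and>
     \<alpha> \<in> index_of S \<rightarrow> index_of T \<and>
     (\<forall>i\<in>index_of S. \<forall>x\<in>space_of S.
        f (map_of_index S i x) = map_of_index T (\<alpha> i) (f x))"

definition restrict_ifs :: "('a, 'i) ifs \<Rightarrow> 'a set \<Rightarrow> ('a, 'i) ifs" where
  "restrict_ifs S A =
     \<lparr>metric_of = submetric (metric_of S) A, index_of = index_of S,
      map_of_index = map_of_index S\<rparr>"

text \<open>
  The maximum metric; the library's \<open>prod_metric\<close> is the Euclidean combination of the two metrics.
\<close>

definition max_metric :: "'a metric \<Rightarrow> 'b metric \<Rightarrow> ('a \<times> 'b) metric" where
  "max_metric m n =
     metric (mspace m \<times> mspace n, \<lambda>p q. max (mdist m (fst p) (fst q)) (mdist n (snd p) (snd q)))"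

lemma Metric_space_max:
  "Metric_space (mspace m \<times> mspace n)
     (\<lambda>p q. max (mdist m (fst p) (fst q)) (mdist n (snd p) (snd q)))"
proof
  fix p q :: "'a \<times> 'b"
  show "0 \<le> max (mdist m (fst p) (fst q)) (mdist n (snd p) (snd q))"
    by (simp add: le_max_iff_disj)
  show "max (mdist m (fst p) (fst q)) (mdist n (snd p) (snd q)) =
        max (mdist m (fst q) (fst p)) (mdist n (snd q) (snd p))"
    by (simp add: mdist_commute)
next
  fix p q :: "'a \<times> 'b"
  assume "p \<in> mspace m \<times> mspace n" "q \<in> mspace m \<times> mspace n"
  then have "mdist m (fst p) (fst q) = 0 \<longleftrightarrow> fst p = fst q"
       and "mdist n (snd p) (snd q) = 0 \<longleftrightarrow> snd p = snd q"
    by auto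
  moreover have "0 \<le> mdist m (fst p) (fst q)" "0 \<le> mdist n (snd p) (snd q)"
    by auto
  moreover have "max a b = 0 \<longleftrightarrow> a = 0 \<and> b = 0" if "0 \<le> a" "0 \<le> b" for a b :: real
    using that by linarith
  ultimately show
    "(max (mdist m (fst p) (fst q)) (mdist n (snd p) (snd q)) = 0) = (p = q)"
    by (simp add: prod_eq_iff)
next
  fix p q r :: "'a \<times> 'b"
  assume "p \<in> mspace m \<times> mspace n" "q \<in> mspace m \<times> mspace n" "r \<in> mspace m \<times> mspace n"
  then have "mdist m (fst p) (fst r) \<le> mdist m (fst p) (fst q) + mdist m (fst q) (fst r)"
       and "mdist n (snd p) (snd r) \<le> mdist n (snd p) (snd q) + mdist n (snd q) (snd r)"
    by (auto intro!: mdist_triangle)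
  then show "max (mdist m (fst p) (fst r)) (mdist n (snd p) (snd r))
     \<le> max (mdist m (fst p) (fst q)) (mdist n (snd p) (snd q)) +
       max (mdist m (fst q) (fst r)) (mdist n (snd q) (snd r))"
    by linarith
qed

lemma mspace_max_metric [simp]: "mspace (max_metric m n) = mspace m \<times> mspace n"
  unfolding max_metric_def by (rule Metric_space.mspace_metric [OF Metric_space_max])

lemma mdist_max_metric [simp]:
  "mdist (max_metric m n) p q = max (mdist m (fst p) (fst q)) (mdist n (snd p) (snd q))"
  unfolding max_metric_def by (simp add: Metric_space.mdist_metric [OF Metric_space_max])

definition fibred_ifs ::
    "('a, 'i) ifs \<Rightarrow> ('b, 'j) ifs \<Rightarrow> ('i \<Rightarrow> 'j) \<Rightarrow> ('a \<times> 'b, 'i) ifs" where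
  "fibred_ifs S T \<alpha> =
     \<lparr>metric_of = max_metric (metric_of S) (metric_of T), index_of = index_of S,
      map_of_index = (\<lambda>i (x, y). (map_of_index S i x, map_of_index T (\<alpha> i) y))\<rparr>"

definition graph_on :: "('a \<Rightarrow> 'b) \<Rightarrow> 'a set \<Rightarrow> ('a \<times> 'b) set" where
  "graph_on f A = {(x, f x) | x. x \<in> A}"

end

theory Submission
  imports Defs
begin

text \<open>
  Both halves rest on two facts about a pair \<open>(f, \<alpha>)\<close>.  First, the relation
  \<open>f (\<gamma> x) = \<alpha>(\<gamma>) (f x)\<close> says precisely that the fibred map \<open>\<gamma>\<^sup>\<alpha>\<close> carries the point \<open>(x, f x)\<close> of
  the graph of \<open>f\<close> to the graph point over \<open>\<gamma> x\<close>.  So if it holds on a set \<open>A\<close> with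
  \<open>\<Gamma>(A) = A\<close>, then the graph of \<open>f\<close> over \<open>A\<close> is fixed by the fibred Hutchinson operator; and if
  conversely a graph over \<open>A\<close> is fixed, the relation can be read off from the second coordinates
  (\<open>hutchinson_fibred_graph\<close>, \<open>fixed_graph_imp_equivariant\<close>).  Second, for compact \<open>A\<close>, continuity
  of \<open>f\<close> on \<open>A\<close> is the same as compactness of its graph (\<open>compactin_graph_on\<close>,
  \<open>continuous_map_of_compact_graph\<close>), because the maximum metric induces the product topology.

  Hence the graph of \<open>f\<close> over the attractor is a nonempty compact fixed point of the fibred system,
  and the first claim follows from uniqueness of such fixed points.  That uniqueness is obtained
  without the Hausdorff metric: a point of a fixed set \<open>K\<close> has preimages in \<open>K\<close> under arbitrarily
  long words of contractions, and applying the same words to points of another fixed set \<open>L\<close> yields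
  points of \<open>L\<close> as close as desired (\<open>subinvariant_subset_superinvariant\<close>).

  In the second claim, the graph of an equivariant continuous \<open>g\<close> is a nonempty compact fixed
  point, so it is the given attractor \<open>D\<close>; and if \<open>D\<close> is a graph, then compactness and invariance
  of \<open>D\<close> give continuity and equivariance of the function.
\<close>

section \<open>Uniqueness of compact invariant sets\<close>

text \<open>
  Finitely many contractions share one contraction factor \<open>c < 1\<close>.  Walking back \<open>n\<close> steps from
  \<open>k \<in> K\<close> inside \<open>K\<close> and forward again, along the same word, from any point of \<open>L\<close> shows that \<open>k\<close> is
  within \<open>c ^ n * M\<close> of \<open>L\<close>, where \<open>M\<close> bounds the distances between \<open>K\<close> and \<open>L\<close>.
\<close>

lemma subinvariant_subset_superinvariant:
  assumes fin: "finite (index_of S)"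
    and contr: "\<And>i. i \<in> index_of S \<Longrightarrow> proper_contraction (metric_of S) (map_of_index S i)"
    and K: "compactin (topology_of S) K" "K \<subseteq> hutchinson S K"
    and L: "compactin (topology_of S) L" "hutchinson S L \<subseteq> L" "L \<noteq> {}"
  shows "K \<subseteq> L"
proof -
  let ?d = "mdist (metric_of S)"
  interpret Metric_space "space_of S" ?d
    by (rule Metric_space_mspace_mdist)
  have top: "topology_of S = mtopology"
    by (simp add: mtopology_of_def)
  have KS: "K \<subseteq> space_of S" and LS: "L \<subseteq> space_of S"
    using compactin_subset_topspace[OF K(1)] compactin_subset_topspace[OF L(1)] by simp_all
  have "\<forall>i\<in>index_of S. \<exists>c. 0 \<le> c \<and> c < 1 \<and> (\<forall>x\<in>space_of S. \<forall>y\<in>space_of S.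
          ?d (map_of_index S i x) (map_of_index S i y) \<le> c * ?d x y)"
    using contr by (auto simp: proper_contraction_def)
  then obtain c where c: "\<And>i. i \<in> index_of S \<Longrightarrow> 0 \<le> c i \<and> c i < 1 \<and>
      (\<forall>x\<in>space_of S. \<forall>y\<in>space_of S.
          ?d (map_of_index S i x) (map_of_index S i y) \<le> c i * ?d x y)"
    by metis
  \<comment> \<open>The inserted \<open>0\<close> only keeps the maximum meaningful for an empty index set.\<close>
  define C where "C = Max (insert 0 (c ` index_of S))"
  have C0: "0 \<le> C" and C1: "C < 1" and cC: "\<And>i. i \<in> index_of S \<Longrightarrow> c i \<le> C"
    using fin c by (auto simp: C_def)
  have "mbounded (K \<union> L)"
    using K(1) L(1) by (simp add: top compactin_imp_mbounded mbounded_Un)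
  then obtain M where M: "\<And>x y. x \<in> K \<Longrightarrow> y \<in> L \<Longrightarrow> ?d x y \<le> M"
    unfolding mbounded_alt by blast
  have approx: "\<exists>l\<in>L. ?d k l \<le> C ^ n * M" if "k \<in> K" for k n
    using that
  proof (induction n arbitrary: k)
    case 0
    then show ?case using M L(3) by fastforce
  next
    case (Suc n)
    then obtain i k' where i: "i \<in> index_of S" and k': "k' \<in> K" "k = map_of_index S i k'"
      using K(2) by (auto simp: hutchinson_def)
    obtain l where l: "l \<in> L" "?d k' l \<le> C ^ n * M"
      using Suc.IH k'(1) by blast
    have "?d k (map_of_index S i l) \<le> c i * ?d k' l"
      using c i k' l KS LS by blast
    also have "\<dots> \<le> C * (C ^ n * M)"
      using cC[OF i] C0 l(2) by (intro mult_mono) auto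
    finally have "?d k (map_of_index S i l) \<le> C ^ Suc n * M"
      by (simp add: mult.assoc)
    moreover have "map_of_index S i l \<in> L"
      using L(2) i l(1) by (auto simp: hutchinson_def)
    ultimately show ?case by blast
  qed
  have "(\<lambda>n. C ^ n * M) \<longlonglongrightarrow> 0"
    using C0 C1 by (intro tendsto_mult_left_zero LIMSEQ_power_zero) auto
  then have small: "\<exists>n. C ^ n * M < r" if "r > 0" for r
    using eventually_happens'[OF sequentially_bot order_tendstoD(2)] that by blast
  have "K \<subseteq> mtopology closure_of L"
  proof
    fix k assume "k \<in> K"
    have "\<exists>y\<in>L. y \<in> mball k r" if "r > 0" for r
    proof -
      obtain n where "C ^ n * M < r"
        using small[OF \<open>r > 0\<close>] by blast
      then obtain l where "l \<in> L" "?d k l < r"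
        using approx[OF \<open>k \<in> K\<close>, of n] by force
      then show ?thesis
        using \<open>k \<in> K\<close> KS LS by auto
    qed
    with \<open>k \<in> K\<close> KS show "k \<in> mtopology closure_of L"
      by (auto simp: metric_closure_of)
  qed
  moreover have "closedin mtopology L"
    using L(1) Hausdorff_space_mtopology by (simp add: top compactin_imp_closedin)
  ultimately show ?thesis
    by (simp add: closure_of_closedin)
qed

lemma fixed_compact_imp_attractor:
  assumes "finite (index_of S)"
    and "\<And>i. i \<in> index_of S \<Longrightarrow> proper_contraction (metric_of S) (map_of_index S i)"
    and "A \<in> nonempty_compacts S" "hutchinson S A = A"
  shows "is_attractor S A"
  unfolding is_attractor_def
proof (intro conjI ballI impI)
  fix K assume "K \<in> nonempty_compacts S" "hutchinson S K = K"
  then show "K = A"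
    using assms subinvariant_subset_superinvariant[of S]
    by (intro equalityI) (auto simp: nonempty_compacts_def)
qed (use assms in auto)

section \<open>The maximum metric and the fibred system\<close>

text \<open>
  The maximum metric and the Euclidean product metric bound each other up to a factor, so the
  identity is Lipschitz in both directions and the two topologies agree.
\<close>

lemma mtopology_of_max_metric:
  "mtopology_of (max_metric m n) = prod_topology (mtopology_of m) (mtopology_of n)"
proof -
  have sqrt_bound: "sqrt (a\<^sup>2 + b\<^sup>2) \<le> 2 * max a b" if "0 \<le> a" "0 \<le> b" for a b :: real
    using sqrt_sum_squares_le_sum[OF that] by linarith
  have "Lipschitz_continuous_map (max_metric m n) (prod_metric m n) id"
    unfolding Lipschitz_continuous_map_def
    by (auto simp: prod_dist_def intro!: exI[of _ 2] sqrt_bound)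
  moreover have "Lipschitz_continuous_map (prod_metric m n) (max_metric m n) id"
    unfolding Lipschitz_continuous_map_def
    by (auto simp: prod_dist_def intro!: exI[of _ 1])
  ultimately have
    "continuous_map (mtopology_of (max_metric m n)) (mtopology_of (prod_metric m n)) id"
    "continuous_map (mtopology_of (prod_metric m n)) (mtopology_of (max_metric m n)) id"
    by (blast intro: Lipschitz_continuous_imp_continuous_map)+
  then have "openin (mtopology_of (max_metric m n)) U \<longleftrightarrow> openin (mtopology_of (prod_metric m n)) U"
    for U
    using topology_finer_continuous_id[of "mtopology_of (max_metric m n)" "mtopology_of (prod_metric m n)"]
      topology_finer_continuous_id[of "mtopology_of (prod_metric m n)" "mtopology_of (max_metric m n)"]
    by auto
  then have "mtopology_of (max_metric m n) = mtopology_of (prod_metric m n)"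
    by (simp add: topology_eq)
  then show ?thesis
    by (simp add: mtopology_of_prod_metric)
qed

lemma topology_of_fibred_ifs:
  "topology_of (fibred_ifs S T \<alpha>) = prod_topology (topology_of S) (topology_of T)"
  by (simp add: fibred_ifs_def mtopology_of_max_metric)

lemma index_of_fibred_ifs [simp]: "index_of (fibred_ifs S T \<alpha>) = index_of S"
  by (simp add: fibred_ifs_def)

lemma proper_contraction_map_prod:
  assumes "proper_contraction m h" "proper_contraction n k"
  shows "proper_contraction (max_metric m n) (\<lambda>(x, y). (h x, k y))"
proof -
  obtain c d where
    c: "0 \<le> c" "c < 1" "\<And>x y. x \<in> mspace m \<Longrightarrow> y \<in> mspace m \<Longrightarrow> mdist m (h x) (h y) \<le> c * mdist m x y"
    and d: "0 \<le> d" "d < 1" "\<And>x y. x \<in> mspace n \<Longrightarrow> y \<in> mspace n \<Longrightarrow> mdist n (k x) (k y) \<le> d * mdist n x y"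
    using assms unfolding proper_contraction_def by meson
  have "max (mdist m (h x) (h x')) (mdist n (k y) (k y'))
          \<le> max c d * max (mdist m x x') (mdist n y y')"
    if "x \<in> mspace m" "x' \<in> mspace m" "y \<in> mspace n" "y' \<in> mspace n" for x x' y y'
  proof (rule max.boundedI)
    show "mdist m (h x) (h x') \<le> max c d * max (mdist m x x') (mdist n y y')"
      by (rule order_trans[OF c(3)], fact, fact, rule mult_mono) (use c(1) in auto)
    show "mdist n (k y) (k y') \<le> max c d * max (mdist m x x') (mdist n y y')"
      by (rule order_trans[OF d(3)], fact, fact, rule mult_mono) (use d(1) in auto)
  qed
  moreover have "0 \<le> max c d" "max c d < 1"
    using c d by auto
  moreover have "(\<lambda>(x, y). (h x, k y)) \<in> mspace m \<times> mspace n \<rightarrow> mspace m \<times> mspace n"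
    using assms by (auto simp: proper_contraction_def)
  ultimately show ?thesis
    unfolding proper_contraction_def by (intro conjI exI[of _ "max c d"]) auto
qed

section \<open>Graphs as compact invariant sets\<close>

lemma compactin_graph_on:
  assumes "compactin X A" "continuous_map (subtopology X A) Y f"
  shows "compactin (prod_topology X Y) (graph_on f A)"
proof -
  have "continuous_map (subtopology X A) (prod_topology X Y) (\<lambda>x. (x, f x))"
    using assms(2) by (simp add: continuous_map_pairedI continuous_map_id_subt[unfolded id_def])
  moreover have "compactin (subtopology X A) A"
    using assms(1) by (simp add: compactin_subtopology)
  ultimately have "compactin (prod_topology X Y) ((\<lambda>x. (x, f x)) ` A)"
    by (rule image_compactin[rotated])
  then show ?thesis
    by (simp add: graph_on_def Setcompr_eq_image)
qed

text \<open>
  The first projection of a compact graph is a continuous bijection onto \<open>A\<close> from a compact to a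
  Hausdorff space, so its inverse \<open>x \<mapsto> (x, h x)\<close> is continuous, and then so is the second coordinate.
\<close>

lemma continuous_map_of_compact_graph:
  assumes "Hausdorff_space X" "compactin (prod_topology X Y) (graph_on h A)"
  shows "continuous_map (subtopology X A) Y h"
proof -
  let ?G = "subtopology (prod_topology X Y) (graph_on h A)"
  have "graph_on h A \<subseteq> topspace (prod_topology X Y)"
    by (rule compactin_subset_topspace[OF assms(2)])
  then have G: "topspace ?G = graph_on h A"
    by auto
  have "continuous_map (subtopology X A) ?G (\<lambda>x. (x, h x))"
  proof (rule continuous_inverse_map)
    show "compact_space ?G"
      by (rule compact_space_subtopology[OF assms(2)])
    show "Hausdorff_space X" by fact
    show "continuous_map ?G X fst"
      by (intro continuous_map_from_subtopology continuous_map_fst)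
    show "\<And>p. p \<in> topspace ?G \<Longrightarrow> (fst p, h (fst p)) = p"
      unfolding G by (auto simp: graph_on_def)
    show "A \<subseteq> fst ` topspace ?G"
      unfolding G by (force simp: graph_on_def)
  qed
  moreover have "continuous_map ?G Y snd"
    by (intro continuous_map_from_subtopology continuous_map_snd)
  ultimately have "continuous_map (subtopology X A) Y (snd \<circ> (\<lambda>x. (x, h x)))"
    by (rule continuous_map_compose)
  then show ?thesis
    by (simp add: o_def)
qed

lemma hutchinson_fibred_graph:
  assumes "\<And>i x. i \<in> index_of S \<Longrightarrow> x \<in> A \<Longrightarrow>
      f (map_of_index S i x) = map_of_index T (\<alpha> i) (f x)"
  shows "hutchinson (fibred_ifs S T \<alpha>) (graph_on f A) = graph_on f (hutchinson S A)"
proof -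
  have graph_image: "graph_on f E = (\<lambda>x. (x, f x)) ` E" for E
    by (auto simp: graph_on_def)
  show ?thesis
    using assms by (simp add: hutchinson_def graph_image fibred_ifs_def image_UN image_image)
qed

text \<open>
  The image of \<open>(x, h x)\<close> under the fibred map of index \<open>i\<close> is again a point of the graph, so its
  second coordinate is the value of \<open>h\<close> at its first.
\<close>

lemma fixed_graph_imp_equivariant:
  assumes "hutchinson (fibred_ifs S T \<beta>) (graph_on h A) \<subseteq> graph_on h A"
    and "i \<in> index_of S" "x \<in> A"
  shows "h (map_of_index S i x) = map_of_index T (\<beta> i) (h x)"
proof -
  have "(map_of_index S i x, map_of_index T (\<beta> i) (h x))
          \<in> hutchinson (fibred_ifs S T \<beta>) (graph_on h A)"
    using assms(2,3) by (force simp: hutchinson_def fibred_ifs_def graph_on_def)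
  then show ?thesis
    using assms(1) by (auto simp: graph_on_def)
qed

lemma graph_on_fixed_compact:
  assumes A: "A \<in> nonempty_compacts S" "hutchinson S A = A"
    and f: "continuous_map (subtopology (topology_of S) A) (topology_of T) f"
    and equiv: "\<And>i x. i \<in> index_of S \<Longrightarrow> x \<in> A \<Longrightarrow>
      f (map_of_index S i x) = map_of_index T (\<alpha> i) (f x)"
  shows "graph_on f A \<in> nonempty_compacts (fibred_ifs S T \<alpha>)"
    and "hutchinson (fibred_ifs S T \<alpha>) (graph_on f A) = graph_on f A"
proof -
  show "graph_on f A \<in> nonempty_compacts (fibred_ifs S T \<alpha>)"
    using A(1) compactin_graph_on[OF _ f]
    by (auto simp: nonempty_compacts_def topology_of_fibred_ifs graph_on_def)
  show "hutchinson (fibred_ifs S T \<alpha>) (graph_on f A) = graph_on f A"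
    using hutchinson_fibred_graph[of S A f T \<alpha>] equiv A(2) by simp
qed

lemma ifs_morphism_restrict_iff:
  assumes "A \<subseteq> space_of S" "B \<subseteq> space_of T"
  shows "ifs_morphism (restrict_ifs S A) (restrict_ifs T B) g \<beta> \<longleftrightarrow>
    continuous_map (subtopology (topology_of S) A) (topology_of T) g \<and> g \<in> A \<rightarrow> B \<and>
    \<beta> \<in> index_of S \<rightarrow> index_of T \<and>
    (\<forall>i\<in>index_of S. \<forall>x\<in>A. g (map_of_index S i x) = map_of_index T (\<beta> i) (g x))"
  using assms
  by (auto simp: ifs_morphism_def restrict_ifs_def mtopology_of_submetric
      continuous_map_in_subtopology inf.absorb1 inf.absorb2)

section \<open>Morphisms and attractors of fibred systems\<close>

theorem theorem4p2:
  fixes S :: "('a, 'i) ifs" and T :: "('b, 'j) ifs"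
    and A :: "'a set" and B :: "'b set"
  assumes "hyperbolic_ifs S" and "hyperbolic_ifs T"
    and "is_attractor S A" and "is_attractor T B"
  shows "(\<forall>f \<alpha>. ifs_morphism S T f \<alpha> \<longrightarrow> is_attractor (fibred_ifs S T \<alpha>) (graph_on f A)) \<and>
    (\<forall>\<beta> D. \<beta> \<in> index_of S \<rightarrow> index_of T \<and> is_attractor (fibred_ifs S T \<beta>) D \<longrightarrow>
           ((\<exists>g. ifs_morphism (restrict_ifs S A) (restrict_ifs T B) g \<beta>) \<longleftrightarrow>
              (\<exists>h. h \<in> A \<rightarrow> B \<and> D = graph_on h A)) \<and>
           (\<forall>h. h \<in> A \<rightarrow> B \<and> D = graph_on h A \<longrightarrow>
              continuous_map (topology_of (restrict_ifs S A)) (topology_of (restrict_ifs T B)) h))"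
proof (intro conjI allI impI)
  have A: "A \<in> nonempty_compacts S" "hutchinson S A = A"
    and AS: "A \<subseteq> space_of S" and BT: "B \<subseteq> space_of T"
    using assms(3,4) compactin_subset_topspace[of "topology_of S" A]
      compactin_subset_topspace[of "topology_of T" B]
    by (simp_all add: is_attractor_def nonempty_compacts_def)
  have haus: "Hausdorff_space (topology_of S)"
    by (simp add: mtopology_of_def Metric_space.Hausdorff_space_mtopology)
  {
    fix f \<alpha>
    assume f: "ifs_morphism S T f \<alpha>"
    have "proper_contraction (metric_of (fibred_ifs S T \<alpha>)) (map_of_index (fibred_ifs S T \<alpha>) i)"
      if "i \<in> index_of S" for i
    proof -
      have "\<alpha> i \<in> index_of T"
        using f that by (auto simp: ifs_morphism_def)
      then show ?thesis
        using assms(1,2) that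
        by (simp add: fibred_ifs_def hyperbolic_ifs_def proper_contraction_map_prod)
    qed
    moreover have "continuous_map (subtopology (topology_of S) A) (topology_of T) f"
      using f by (simp add: ifs_morphism_def continuous_map_from_subtopology)
    moreover have "f (map_of_index S i x) = map_of_index T (\<alpha> i) (f x)"
      if "i \<in> index_of S" "x \<in> A" for i x
      using f AS that by (auto simp: ifs_morphism_def)
    ultimately show "is_attractor (fibred_ifs S T \<alpha>) (graph_on f A)"
      using assms(1) graph_on_fixed_compact[OF A, of T f \<alpha>]
      by (intro fixed_compact_imp_attractor) (auto simp: hyperbolic_ifs_def)
  next
    fix \<beta> D
    assume \<beta>D: "\<beta> \<in> index_of S \<rightarrow> index_of T \<and> is_attractor (fibred_ifs S T \<beta>) D"
    have cont: "continuous_map (subtopology (topology_of S) A) (topology_of T) h"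
      if "D = graph_on h A" for h
      using \<beta>D that haus
      by (intro continuous_map_of_compact_graph)
         (auto simp: is_attractor_def nonempty_compacts_def topology_of_fibred_ifs)
    show "(\<exists>g. ifs_morphism (restrict_ifs S A) (restrict_ifs T B) g \<beta>) \<longleftrightarrow>
          (\<exists>h. h \<in> A \<rightarrow> B \<and> D = graph_on h A)"
    proof (intro iffI; elim exE conjE)
      fix g
      assume "ifs_morphism (restrict_ifs S A) (restrict_ifs T B) g \<beta>"
      then have g: "continuous_map (subtopology (topology_of S) A) (topology_of T) g" "g \<in> A \<rightarrow> B"
        "\<And>i x. i \<in> index_of S \<Longrightarrow> x \<in> A \<Longrightarrow>
           g (map_of_index S i x) = map_of_index T (\<beta> i) (g x)"
        by (auto simp: ifs_morphism_restrict_iff[OF AS BT])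
      have "D = graph_on g A"
        using \<beta>D graph_on_fixed_compact[OF A g(1,3)] by (auto simp: is_attractor_def)
      then show "\<exists>h. h \<in> A \<rightarrow> B \<and> D = graph_on h A"
        using g(2) by blast
    next
      fix h
      assume h: "h \<in> A \<rightarrow> B" "D = graph_on h A"
      then have "h (map_of_index S i x) = map_of_index T (\<beta> i) (h x)"
        if "i \<in> index_of S" "x \<in> A" for i x
        using \<beta>D that by (intro fixed_graph_imp_equivariant) (auto simp: is_attractor_def)
      then show "\<exists>g. ifs_morphism (restrict_ifs S A) (restrict_ifs T B) g \<beta>"
        using h(1) cont[OF h(2)] \<beta>D
        by (intro exI[of _ h]) (simp add: ifs_morphism_restrict_iff[OF AS BT])
    qed
    fix h
    assume "h \<in> A \<rightarrow> B \<and> D = graph_on h A"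
    then show "continuous_map (topology_of (restrict_ifs S A)) (topology_of (restrict_ifs T B)) h"
      using cont AS
      by (auto simp: restrict_ifs_def mtopology_of_submetric continuous_map_in_subtopology)
  }
qed

end
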